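(* Let $d\ge 1$ and $m\ge 2$ be integers, let $\boldsymbol{\Omega}=\{\Omega_{\boldsymbol{i}}:\boldsymbol{i}\in\mathbb{N}_m^d\}$ be the jittered partition of $[0,1]^d$ into $m^d$ cubes, and let $\mathcal{P}_{\boldsymbol{\Omega}}$ be the associated jittered point set of $N=m^d$ random points. Then $$\mathbb{E}\,\mathcal{L}_2^2(\mathcal{P}_{\boldsymbol{\Omega}})=\frac{1}{m^{2d}}\left[\left(\frac{m-1}{2}+\frac12\right)^d-\left(\frac{m-1}{2}+\frac13\right)^d\right].$$
   Context: $\mathbb{N}_m^d$ is the set of $d$-tuples $\boldsymbol{i}=(i_1,\dots,i_d)$ with entries in $\{1,\dots,m\}$. The jittered partition of $[0,1]^d$ consists of the $m^d$ axis-aligned cubes $\Omega_{\boldsymbol{i}}=\prod_{j=1}^d\left[\frac{i_j-1}{m},\frac{i_j}{m}\right]$, $\boldsymbol{i}\in\mathbb{N}_m^d$, of equal volume $m^{-d}$ (they overlap only on boundaries). The jittered point set $\mathcal{P}_{\boldsymbol{\Omega}}$ consists of $N=m^d$ independent random points, one uniformly distributed in each $\Omega_{\boldsymbol{i}}$. For a point set $\mathcal{P}=\{\mathbf{x}_1,\dots,\mathbf{x}_N\}\subset[0,1]^d$, the $\mathcal{L}_2$-discrepancy is $$\mathcal{L}_2(\mathcal{P})=\left(\int_{[0,1]^d}\left|\frac{\#(\mathcal{P}\cap[0,\mathbf{x}))}{N}-|[0,\mathbf{x})|\right|^2d\mathbf{x}\right)^{1/2},$$ where $[0,\mathbf{x})=\prod_{j=1}^d[0,x_j)$,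 $|\cdot|$ of a set is Lebesgue measure, and $\#(\mathcal{P}\cap[0,\mathbf{x}))$ is the number of indices $k\in\{1,\dots,N\}$ with $\mathbf{x}_k\in[0,\mathbf{x})$. $\mathbb{E}\mathcal{L}_2^2(\mathcal{P})$ means $\mathbb{E}[\mathcal{L}_2(\mathcal{P})^2]$. *)

theory Defs
  imports "HOL-Probability.Probability"
begin

text \<open>
  The dimension \<open>d\<close> is \<open>CARD('d)\<close> for the finite type \<open>'d\<close> of coordinates.
\<close>

definition multi_indices :: "nat \<Rightarrow> (nat ^ 'd) set" where
  "multi_indices m = {i. \<forall>j. i $ j \<in> {1..m}}"

definition jittered_cube :: "nat \<Rightarrow> nat ^ 'd \<Rightarrow> (real ^ 'd) set" where
  "jittered_cube m i = {x. \<forall>j. x $ j \<in> {(real (i $ j) - 1) / real m .. real (i $ j) / real m}}"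

definition anchored_box :: "real ^ 'd \<Rightarrow> (real ^ 'd) set" where
  "anchored_box x = {y. \<forall>j. y $ j \<in> {0..<x $ j}}"

text \<open>
  A point set is a family \<open>p\<close> over a finite index set \<open>I\<close>, with \<open>N = card I\<close>; points are counted
  by index, so coinciding points count with multiplicity.
\<close>

definition L2_discrepancy :: "'i set \<Rightarrow> ('i \<Rightarrow> real ^ 'd) \<Rightarrow> real" where
  "L2_discrepancy I p = sqrt (LINT x:{x. \<forall>j. x $ j \<in> {0..1}}|lborel.
     \<bar>real (card {k \<in> I. p k \<in> anchored_box x}) / real (card I) - measure lborel (anchored_box x)\<bar>\<^sup>2)"

text \<open>
  Independence over \<open>multi_indices m\<close> includes Borel measurability of the random points there;
  nothing is required of \<open>X i\<close> for other \<open>i\<close>.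
\<close>

definition jittered_sample :: "nat \<Rightarrow> 'w measure \<Rightarrow> (nat ^ 'd \<Rightarrow> 'w \<Rightarrow> real ^ 'd) \<Rightarrow> bool" where
  "jittered_sample m M X \<longleftrightarrow>
     prob_space M \<and>
     prob_space.indep_vars M (\<lambda>_. borel) X (multi_indices m) \<and>
     (\<forall>i \<in> multi_indices m. distr M borel (X i) = uniform_measure lborel (jittered_cube m i))"

end

theory Submission
  imports Defs
begin

text \<open>
  At a fixed point \<open>x\<close> of the unit cube, the number of sample points in the box \<open>[0, x)\<close> is a sum
  of independent Bernoulli variables, one for each cube of the partition. The success probability
  \<open>p i x\<close> of the variable of cube \<open>i\<close> is the fraction of that cube covered by the box. These
  probabilities sum to \<open>m ^ d\<close> times the volume of the box, because the cubes have equal volume and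
  tile the unit cube. The local discrepancy is therefore a centred count divided by \<open>m ^ d\<close>, its
  expected square is a variance, and by independence this equals \<open>(\<Sum>i. p i x - (p i x)\<^sup>2) / m ^ (2 * d)\<close>
  (\<open>variance_count_indep_events\<close>). By Fubini's theorem the expected squared discrepancy is the
  integral of this variance over the unit cube (\<open>expectation_L2_discrepancy_squared_swap\<close>).

  Everything now factors over the coordinates. With \<open>q k t\<close> the fraction of the \<open>k\<close>-th interval
  of the grid on \<open>[0, 1]\<close> that lies below \<open>t\<close>, the probability \<open>p i x\<close> is the product of the
  \<open>q (i\<^sub>j) (x\<^sub>j)\<close>. The integral of a product of one-dimensional functions is the product of their
  integrals, and a sum over all multi-indices of such products is a product of sums over \<open>k\<close>. Hence
  the integral of \<open>\<Sum>i. (p i x) ^ n\<close> is the \<open>d\<close>-th power of the one-dimensional quantity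
  \<open>\<Sum>k. \<integral> (q k t) ^ n dt\<close>. The \<open>k\<close>-th summand is \<open>1 / ((n + 1) * m)\<close>, from the interval itself,
  plus \<open>(m - k) / m\<close>, from the region to its right where \<open>q k = 1\<close>; the total is
  \<open>(m - 1) / 2 + 1 / (n + 1)\<close>. The cases \<open>n = 1\<close> and \<open>n = 2\<close> are the two powers in the formula.
\<close>

section \<open>Product integrals in real coordinates\<close>

lemma measurable_vec_nth_compose [measurable (raw)]:
  fixes f :: "'a \<Rightarrow> real ^ 'd"
  assumes "f \<in> borel_measurable N"
  shows "(\<lambda>w. f w $ j) \<in> borel_measurable N"
  using measurable_compose[OF assms borel_measurable_nth] .

lemma prod_Basis_axis_index: "(\<Prod>b\<in>(Basis :: (real ^ 'd) set). g (axis_index b)) = (\<Prod>j\<in>UNIV. g j)"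
proof (rule prod.reindex_bij_witness[where i = "\<lambda>j. axis j 1" and j = axis_index])
  show "axis (axis_index b) 1 = b" if "b \<in> Basis" for b :: "real ^ 'd"
    using axis_index[OF that] by simp
qed (auto simp: axis_in_Basis_iff)

text \<open>
  Lebesgue measure is the product measure over the standard basis, and basis vectors correspond to
  coordinates. Nonnegativity lets the nonnegative integral, where no integrability is at issue,
  do the work.
\<close>

lemma has_bochner_integral_vec_prod:
  fixes f :: "'d::finite \<Rightarrow> real \<Rightarrow> real"
  assumes int: "\<And>j. has_bochner_integral lborel (f j) (c j)"
    and nonneg: "\<And>j t. 0 \<le> f j t"
  shows "has_bochner_integral lborel (\<lambda>x::real^'d. \<Prod>j\<in>UNIV. f j (x $ j)) (\<Prod>j\<in>UNIV. c j)"
proof (rule has_bochner_integral_nn_integral)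
  have [measurable]: "f j \<in> borel_measurable borel" for j
    using int[of j] by (auto simp: has_bochner_integral_iff)
  have c: "0 \<le> c j" for j
    using int[of j] Bochner_Integration.integral_nonneg[of lborel "f j"] nonneg by (simp add: has_bochner_integral_iff)
  show "(\<lambda>x::real^'d. \<Prod>j\<in>UNIV. f j (x $ j)) \<in> borel_measurable lborel"
    by measurable
  have nn: "(\<integral>\<^sup>+t. f j t \<partial>lborel) = ennreal (c j)" for j
    using int[of j] nonneg by (subst nn_integral_eq_integral) (auto simp: has_bochner_integral_iff)
  have "(\<integral>\<^sup>+x. (\<Prod>j\<in>UNIV. f j (x $ j)) \<partial>lborel)
      = (\<integral>\<^sup>+x. (\<Prod>b\<in>Basis. ennreal (f (axis_index b) ((x :: real ^ 'd) \<bullet> b))) \<partial>lborel)"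
  proof (rule nn_integral_cong)
    fix x :: "real ^ 'd"
    have "(\<Prod>b\<in>Basis. f (axis_index b) (x \<bullet> b)) = (\<Prod>b\<in>(Basis::(real^'d) set). f (axis_index b) (x $ axis_index b))"
    proof (rule prod.cong)
      fix b :: "real ^ 'd" assume "b \<in> Basis"
      then show "f (axis_index b) (x \<bullet> b) = f (axis_index b) (x $ axis_index b)"
        using axis_index[of b] by (metis cart_eq_inner_axis)
    qed simp
    also have "\<dots> = (\<Prod>j\<in>UNIV. f j (x $ j))"
      by (rule prod_Basis_axis_index[where g = "\<lambda>j. f j (x $ j)"])
    finally show "ennreal (\<Prod>j\<in>UNIV. f j (x $ j)) = (\<Prod>b\<in>Basis. ennreal (f (axis_index b) (x \<bullet> b)))"
      by (simp add: prod_ennreal nonneg)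
  qed
  also have "\<dots> = (\<Prod>b\<in>(Basis :: (real^'d) set). \<integral>\<^sup>+t. f (axis_index b) t \<partial>lborel)"
    using nn_integral_lborel_prod[where f = "\<lambda>b::real^'d. f (axis_index b)"] nonneg
    by (simp add: prod_ennreal)
  also have "\<dots> = (\<Prod>j\<in>UNIV. \<integral>\<^sup>+t. f j t \<partial>lborel)"
    by (rule prod_Basis_axis_index[where g = "\<lambda>j. \<integral>\<^sup>+t. f j t \<partial>lborel"])
  finally show "(\<integral>\<^sup>+x. (\<Prod>j\<in>UNIV. f j (x $ j)) \<partial>lborel) = ennreal (\<Prod>j\<in>UNIV. c j)"
    by (simp add: nn prod_ennreal c)
  show "0 \<le> (\<Prod>j\<in>UNIV. c j)" by (simp add: prod_nonneg c)
qed (auto simp: prod_nonneg nonneg)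

lemma measure_lborel_vec_box:
  fixes A :: "'d::finite \<Rightarrow> real set"
  assumes "\<And>j. A j \<in> sets borel" "\<And>j. emeasure lborel (A j) < \<infinity>"
  shows "measure lborel {x::real^'d. \<forall>j. x $ j \<in> A j} = (\<Prod>j\<in>UNIV. measure lborel (A j))"
proof -
  have "has_bochner_integral lborel (\<lambda>x::real^'d. \<Prod>j\<in>UNIV. indicator (A j) (x $ j) :: real)
      (\<Prod>j\<in>UNIV. measure lborel (A j))"
  proof (rule has_bochner_integral_vec_prod)
    show "has_bochner_integral lborel (indicator (A j) :: real \<Rightarrow> real) (measure lborel (A j))" for j
      by (rule has_bochner_integral_real_indicator) (use assms in simp_all)
  qed simp
  also have "(\<lambda>x::real^'d. \<Prod>j\<in>UNIV. indicator (A j) (x $ j) :: real) = indicator {x. \<forall>j. x $ j \<in> A j}"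
    by (auto simp: fun_eq_iff indicator_def)
  finally show ?thesis
    by (auto simp: has_bochner_integral_iff)
qed

section \<open>The fraction of a grid interval below a point\<close>

text \<open>
  The argument \<open>u = m * t - (k - 1)\<close> is the coordinate in which the \<open>k\<close>-th interval of the grid is
  \<open>[0, 1]\<close>; clamping it gives the fraction of that interval to the left of \<open>t\<close>.
\<close>

definition fraction_below :: "nat \<Rightarrow> nat \<Rightarrow> real \<Rightarrow> real" where
  "fraction_below m k t = max 0 (min 1 (real m * t - (real k - 1)))"

lemma fraction_below_nonneg: "0 \<le> fraction_below m k t"
  by (simp add: fraction_below_def)

lemma measurable_fraction_below [measurable]: "fraction_below m k \<in> borel_measurable borel"
  unfolding fraction_below_def[abs_def] by measurable

text \<open>
  For \<open>v = m * t \<ge> 0\<close>, the clamp of \<open>v - (k - 1)\<close> to the unit interval is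
  \<open>min v k - min v (k - 1)\<close>, so the sum telescopes.
\<close>

lemma sum_fraction_below:
  assumes "0 \<le> t" "t \<le> 1"
  shows "(\<Sum>k\<in>{1..m}. fraction_below m k t) = real m * t"
proof -
  have "(\<Sum>k\<in>{1..n}. fraction_below m k t) = min (real m * t) (real n)" for n
  proof (induction n)
    case 0
    then show ?case using assms by simp
  next
    case (Suc n)
    then show ?case by (simp add: fraction_below_def)
  qed
  moreover have "real m * t \<le> real m"
    using assms by (simp add: mult_left_le)
  ultimately show ?thesis by simp
qed

text \<open>
  The integrand vanishes to the left of the grid interval, is \<open>u ^ n\<close> in the rescaled coordinate
  \<open>u\<close> on it, and is 1 on the remaining \<open>m - k\<close> intervals.
\<close>

lemma has_bochner_integral_fraction_below_power:
  assumes k: "1 \<le> k" "k \<le> m" and n: "0 < n"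
  shows "has_bochner_integral lborel (\<lambda>t. indicator {0..1} t * fraction_below m k t ^ n)
    (1 / (real (n + 1) * real m) + real (m - k) / real m)"
proof -
  define a b where "a = (real k - 1) / real m" and "b = real k / real m"
  have m: "real m > 0" using k by simp
  have ab: "a \<le> b" "0 \<le> a" "b \<le> 1"
    using k m by (auto simp: a_def b_def divide_simps)
  define F where "F t = (real m * t - (real k - 1)) ^ Suc n / (real (n + 1) * real m)" for t
  have "has_bochner_integral lborel (\<lambda>t. (real m * t - (real k - 1)) ^ n * indicator {a..b} t) (F b - F a)"
  proof (rule has_bochner_integral_FTC_Icc_real)
    fix t
    show "DERIV F t :> (real m * t - (real k - 1)) ^ n"
    proof -
      have "((\<lambda>t. real m * t - (real k - 1)) has_real_derivative real m) (at t)"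
        by (auto intro!: derivative_eq_intros)
      moreover have nz: "real (n + 1) * real m \<noteq> 0"
        using m by simp
      ultimately show ?thesis
        unfolding F_def by (intro DERIV_cong[OF DERIV_cdivide[OF DERIV_power_Suc]])
          (assumption, subst nonzero_divide_eq_eq[OF nz], simp add: algebra_simps)
    qed
    show "isCont (\<lambda>t. (real m * t - (real k - 1)) ^ n) t"
      by (intro continuous_intros)
  qed (rule ab)
  moreover have "has_bochner_integral lborel (indicator {b<..1} :: real \<Rightarrow> real) (measure lborel {b<..1})"
    by (rule has_bochner_integral_real_indicator) (auto simp: ab)
  ultimately have "has_bochner_integral lborel
      (\<lambda>t. (real m * t - (real k - 1)) ^ n * indicator {a..b} t + indicator {b<..1} t)
      (F b - F a + measure lborel {b<..1})"
    by (rule has_bochner_integral_add)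
  also have "F b - F a = 1 / (real (n + 1) * real m)"
    using m by (simp add: F_def a_def b_def)
  also have "measure lborel {b<..1} = real (m - k) / real m"
    using ab k m by (simp add: b_def of_nat_diff field_simps)
  also have "(\<lambda>t. (real m * t - (real k - 1)) ^ n * indicator {a..b} t + indicator {b<..1} t)
      = (\<lambda>t. indicator {0..1} t * fraction_below m k t ^ n)"
  proof
    fix t
    consider "t < a" | "a \<le> t" "t \<le> b" | "b < t" by linarith
    then show "(real m * t - (real k - 1)) ^ n * indicator {a..b} t + indicator {b<..1} t
      = indicator {0..1} t * fraction_below m k t ^ n"
    proof cases
      case 1
      then have "fraction_below m k t = 0"
        using m by (simp add: a_def fraction_below_def field_simps)
      then show ?thesis using 1 ab n by simp
    next
      case 2
      then have "fraction_below m k t = real m * t - (real k - 1)"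
        using m by (simp add: a_def b_def fraction_below_def field_simps)
      then show ?thesis using 2 ab by (simp add: indicator_def)
    next
      case 3
      then have "fraction_below m k t = 1"
        using m by (simp add: b_def fraction_below_def field_simps)
      then show ?thesis using 3 ab by (simp add: indicator_def)
    qed
  qed
  finally show ?thesis .
qed

text \<open>
  With \<open>c = 1 / (n + 1)\<close> the summands are the integrals of
  \<open>has_bochner_integral_fraction_below_power\<close>.
\<close>

lemma sum_fraction_below_integrals:
  assumes "0 < m"
  shows "(\<Sum>k\<in>{1..m}. c / real m + real (m - k) / real m) = (real m - 1) / 2 + c"
proof -
  have "(\<Sum>k\<in>{1..m}. real (m - k)) = (\<Sum>k<m. real k)"
    by (rule sum.reindex_bij_witness[where i = "\<lambda>k. m - k" and j = "\<lambda>k. m - k"]) auto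
  also have "\<dots> = real m * (real m - 1) / 2"
    by (induction m) (auto simp: field_simps)
  finally show ?thesis
    using assms by (simp add: sum.distrib flip: sum_divide_distrib)
qed

section \<open>The variance of a count of independent events\<close>

text \<open>
  Expand the square of the sum of the centred indicators \<open>Z k\<close>: independence makes the mixed terms
  vanish, and a diagonal term is the variance of a Bernoulli variable.
\<close>

lemma (in prob_space) variance_count_indep_events:
  assumes I: "finite I" and indep: "indep_vars (\<lambda>_. N) X I" and B: "B \<in> sets N"
  defines "p \<equiv> \<lambda>k. measure (distr M N (X k)) B"
  shows "expectation (\<lambda>\<omega>. (real (card {k\<in>I. X k \<omega> \<in> B}) - (\<Sum>k\<in>I. p k))\<^sup>2) = (\<Sum>k\<in>I. p k - (p k)\<^sup>2)"
proof -
  define Z where "Z k \<omega> = indicator B (X k \<omega>) - p k" for k \<omega>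
  have X: "X k \<in> measurable M N" if "k \<in> I" for k
    using indep that by (auto simp: indep_vars_def)
  have indicator_meas: "(\<lambda>\<omega>. indicator B (X k \<omega>) :: real) \<in> borel_measurable M" if "k \<in> I" for k
    using X[OF that] B by measurable
  have int_indicator: "integrable M (\<lambda>\<omega>. indicator B (X k \<omega>) :: real)" if "k \<in> I" for k
    by (rule integrable_const_bound[where B = 1]) (auto simp: indicator_meas that)
  have E_indicator: "expectation (\<lambda>\<omega>. indicator B (X k \<omega>)) = p k" if "k \<in> I" for k
    using integral_distr[OF X[OF that], of "indicator B :: _ \<Rightarrow> real"] B
    by (simp add: p_def)
  have int_Z: "integrable M (Z k)" and E_Z: "expectation (Z k) = 0" if "k \<in> I" for k
    using int_indicator[OF that] E_indicator[OF that] by (auto simp: Z_def[abs_def] prob_space)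
  have indep_Z: "indep_vars (\<lambda>_. borel) Z I"
    using indep_vars_compose2[OF indep, of "\<lambda>k x. indicator B x - p k" "\<lambda>_. borel :: real measure"] B
    by (simp add: Z_def[abs_def])
  have ZZ: "has_bochner_integral M (\<lambda>\<omega>. Z k \<omega> * Z l \<omega>) (if k = l then p k - (p k)\<^sup>2 else 0)"
    if kl: "k \<in> I" "l \<in> I" for k l
  proof (cases "k = l")
    case True
    \<comment> \<open>Indicators are idempotent, so the square of \<open>Z k\<close> is affine in the indicator.\<close>
    have "(\<lambda>\<omega>. Z k \<omega> * Z l \<omega>) = (\<lambda>\<omega>. (1 - 2 * p k) * indicator B (X k \<omega>) + (p k)\<^sup>2)"
      using True by (auto simp: Z_def fun_eq_iff indicator_def power2_eq_square algebra_simps)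
    moreover have "(if k = l then p k - (p k)\<^sup>2 else 0) = (1 - 2 * p k) * p k + (p k)\<^sup>2"
      using True by (simp add: power2_eq_square algebra_simps)
    ultimately show ?thesis
      using int_indicator E_indicator kl
      by (simp only: has_bochner_integral_iff) (simp add: prob_space)
  next
    case False
    have "indep_vars (\<lambda>_. borel) Z {k, l}"
      using indep_Z kl by (auto intro: indep_vars_subset)
    then have "has_bochner_integral M (\<lambda>\<omega>. \<Prod>i\<in>{k, l}. Z i \<omega>) (\<Prod>i\<in>{k, l}. expectation (Z i))"
      using indep_vars_lebesgue_integral[of "{k, l}" Z] indep_vars_integrable[of "{k, l}" Z] int_Z kl
      by (auto simp: has_bochner_integral_iff)
    then show ?thesis using False E_Z kl by simp
  qed
  have "real (card {k\<in>I. X k \<omega> \<in> B}) = (\<Sum>k\<in>I. indicator B (X k \<omega>))" for \<omega>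
    using I by (simp add: indicator_def sum.If_cases Int_def)
  then have "(real (card {k\<in>I. X k \<omega> \<in> B}) - (\<Sum>k\<in>I. p k))\<^sup>2 = (\<Sum>k\<in>I. \<Sum>l\<in>I. Z k \<omega> * Z l \<omega>)" for \<omega>
    by (simp add: Z_def sum_subtractf power2_eq_square flip: sum_product)
  moreover have "has_bochner_integral M (\<lambda>\<omega>. \<Sum>k\<in>I. \<Sum>l\<in>I. Z k \<omega> * Z l \<omega>)
      (\<Sum>k\<in>I. \<Sum>l\<in>I. if k = l then p k - (p k)\<^sup>2 else 0)"
    by (intro has_bochner_integral_sum ZZ)
  ultimately show ?thesis
    using I by (simp add: has_bochner_integral_iff)
qed

section \<open>The jittered partition\<close>

lemma sum_multi_indices_prod:
  fixes f :: "'d::finite \<Rightarrow> nat \<Rightarrow> 'a::comm_semiring_1"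
  shows "(\<Sum>i\<in>multi_indices m. \<Prod>j\<in>UNIV. f j (i $ j)) = (\<Prod>j\<in>UNIV. \<Sum>k\<in>{1..m}. f j k)"
proof -
  have "(\<Sum>i\<in>multi_indices m. \<Prod>j\<in>UNIV. f j (i $ j)) = (\<Sum>g\<in>PiE UNIV (\<lambda>_. {1..m}). \<Prod>j\<in>UNIV. f j (g j))"
    by (rule sum.reindex_bij_witness[where i = "\<lambda>g. \<chi> j. g j" and j = "\<lambda>i. ($) i"])
      (auto simp: multi_indices_def PiE_iff)
  then show ?thesis by (simp add: prod_sum_PiE)
qed

lemma card_multi_indices: "card (multi_indices m :: (nat ^ 'd) set) = m ^ CARD('d)"
  using sum_multi_indices_prod[where f = "\<lambda>(_::'d) _. 1 :: nat" and m = m] by simp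

lemma finite_multi_indices: "finite (multi_indices m :: (nat ^ 'd) set)"
proof -
  have "multi_indices m \<subseteq> (\<lambda>g. \<chi> j. g j) ` PiE (UNIV :: 'd set) (\<lambda>_. {1..m})"
  proof
    fix i :: "nat ^ 'd" assume "i \<in> multi_indices m"
    then show "i \<in> (\<lambda>g. \<chi> j. g j) ` PiE (UNIV :: 'd set) (\<lambda>_. {1..m})"
      by (intro image_eqI[where x = "($) i"]) (auto simp: multi_indices_def)
  qed
  then show ?thesis by (rule finite_subset) (intro finite_imageI finite_PiE, auto)
qed

lemma measure_anchored_box:
  fixes x :: "real ^ 'd"
  assumes "\<And>j. 0 \<le> x $ j"
  shows "measure lborel (anchored_box x) = (\<Prod>j\<in>UNIV. x $ j)"
  unfolding anchored_box_def using assms by (subst measure_lborel_vec_box) auto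

lemma anchored_box_borel [measurable]: "anchored_box x \<in> sets borel"
  unfolding anchored_box_def by measurable

lemma measure_jittered_cube:
  assumes "0 < m"
  shows "measure lborel (jittered_cube m (i :: nat ^ 'd)) = 1 / real m ^ CARD('d)"
proof -
  have "measure lborel {(real (i $ j) - 1) / real m..real (i $ j) / real m} = 1 / real m" for j
    using assms by (simp add: divide_right_mono flip: diff_divide_distrib)
  then show ?thesis
    unfolding jittered_cube_def using assms
    by (subst measure_lborel_vec_box) (auto simp: divide_right_mono power_one_over)
qed

text \<open>
  Box and cube are both products of intervals, so their intersection can be measured coordinate by
  coordinate; this is the one-dimensional factor.
\<close>

lemma measure_grid_interval_below:
  assumes "0 < m" "1 \<le> k"
  shows "measure lborel ({(real k - 1) / real m..real k / real m} \<inter> {0..<t}) = fraction_below m k t / real m"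
proof -
  define a b where "a = (real k - 1) / real m" and "b = real k / real m"
  have m: "real m > 0" using assms by simp
  have ab: "a \<le> b" "0 \<le> a"
    using assms m by (auto simp: a_def b_def divide_simps)
  consider "t < a" | "a \<le> t" "t \<le> b" | "b < t" by linarith
  then have "measure lborel ({a..b} \<inter> {0..<t}) = fraction_below m k t / real m"
  proof cases
    case 1
    then have "{a..b} \<inter> {0..<t} = {}" by auto
    moreover have "fraction_below m k t = 0"
      using 1 m by (simp add: a_def fraction_below_def field_simps)
    ultimately show ?thesis by simp
  next
    case 2
    then have "{a..b} \<inter> {0..<t} = {a..<t}" using ab by auto
    moreover have "fraction_below m k t = real m * t - (real k - 1)"
      using 2 m by (simp add: a_def b_def fraction_below_def field_simps)
    ultimately show ?thesis using 2 m by (simp add: a_def field_simps)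
  next
    case 3
    then have "{a..b} \<inter> {0..<t} = {a..b}" using ab by auto
    moreover have "fraction_below m k t = 1"
      using 3 m by (simp add: b_def fraction_below_def field_simps)
    ultimately show ?thesis using ab m by (simp add: a_def b_def field_simps)
  qed
  then show ?thesis by (simp add: a_def b_def)
qed

lemma measure_uniform_jittered_cube_anchored_box:
  fixes x :: "real ^ 'd"
  assumes m: "0 < m" and i: "i \<in> multi_indices m"
  shows "measure (uniform_measure lborel (jittered_cube m i)) (anchored_box x)
    = (\<Prod>j\<in>UNIV. fraction_below m (i $ j) (x $ j))"
proof -
  have "jittered_cube m i \<inter> anchored_box x
      = {y. \<forall>j. y $ j \<in> {(real (i $ j) - 1) / real m..real (i $ j) / real m} \<inter> {0..<x $ j}}"
    by (auto simp: jittered_cube_def anchored_box_def)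
  then have "measure lborel (jittered_cube m i \<inter> anchored_box x)
      = (\<Prod>j\<in>UNIV. measure lborel ({(real (i $ j) - 1) / real m..real (i $ j) / real m} \<inter> {0..<x $ j}))"
  proof (simp only:, intro measure_lborel_vec_box)
    show "emeasure lborel ({(real (i $ j) - 1) / real m..real (i $ j) / real m} \<inter> {0..<x $ j}) < \<infinity>" for j
      by (rule le_less_trans[OF emeasure_mono[of _ "{(real (i $ j) - 1) / real m..real (i $ j) / real m}"]])
        (auto simp: emeasure_lborel_Icc_eq)
  qed auto
  also have "\<dots> = (\<Prod>j\<in>UNIV. fraction_below m (i $ j) (x $ j) / real m)"
    using i m by (intro prod.cong measure_grid_interval_below) (auto simp: multi_indices_def)
  finally have "measure lborel (jittered_cube m i \<inter> anchored_box x)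
      = (\<Prod>j\<in>UNIV. fraction_below m (i $ j) (x $ j)) / real m ^ CARD('d)"
    by (simp add: prod_dividef)
  \<comment> \<open>The real-valued \<open>measure\<close> is 0 on null sets and on sets of infinite measure, so its positivity
    excludes both.\<close>
  moreover have "emeasure lborel (jittered_cube m i) \<noteq> 0" "emeasure lborel (jittered_cube m i) \<noteq> \<infinity>"
    using measure_jittered_cube[OF m, of i] m by (auto simp: measure_def)
  ultimately show ?thesis
    using m by (simp add: measure_jittered_cube)
qed

section \<open>The expected squared discrepancy\<close>

lemma L2_discrepancy_squared:
  "(L2_discrepancy I p)\<^sup>2 = (LINT x:{x. \<forall>j. x $ j \<in> {0..1}}|lborel.
     (real (card {k \<in> I. p k \<in> anchored_box x}) / real (card I) - measure lborel (anchored_box x))\<^sup>2)"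
  by (simp add: L2_discrepancy_def set_lebesgue_integral_def integral_nonneg_AE)

text \<open>
  The local discrepancy is bounded by 1 on the unit cube, which has finite measure, so Fubini's
  theorem applies once joint measurability in sample and box corner is known.
\<close>

lemma expectation_L2_discrepancy_squared_swap:
  fixes X :: "'i \<Rightarrow> 'w \<Rightarrow> real ^ 'd"
  assumes M: "prob_space M" and I: "finite I" and X: "\<And>k. k \<in> I \<Longrightarrow> X k \<in> borel_measurable M"
  shows "prob_space.expectation M (\<lambda>\<omega>. (L2_discrepancy I (\<lambda>k. X k \<omega>))\<^sup>2) =
    (LINT x:{x. \<forall>j. x $ j \<in> {0..1}}|lborel. prob_space.expectation M (\<lambda>\<omega>.
      (real (card {k \<in> I. X k \<omega> \<in> anchored_box x}) / real (card I) - measure lborel (anchored_box x))\<^sup>2))"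
proof -
  interpret prob_space M by fact
  interpret pair_sigma_finite M "lborel :: (real ^ 'd) measure" ..
  let ?C = "{x::real^'d. \<forall>j. x $ j \<in> {0..1}}"
  define D where "D \<omega> x = real (card {k \<in> I. X k \<omega> \<in> anchored_box x}) / real (card I) - measure lborel (anchored_box x)" for \<omega> x
  \<comment> \<open>The cardinality and the volume in \<open>D\<close> hide the dependence on both variables; on the unit cube
    \<open>S\<close> agrees with \<open>D\<close> and is visibly measurable.\<close>
  define S where "S \<omega> x = (\<Sum>k\<in>I. if \<forall>j. 0 \<le> X k \<omega> $ j \<and> X k \<omega> $ j < x $ j then 1 else 0 :: real) / real (card I)
      - (\<Prod>j\<in>UNIV. x $ j)" for \<omega> x
  have D_eq: "D \<omega> x = S \<omega> x" if "x \<in> ?C" for \<omega> x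
  proof -
    have "real (card {k \<in> I. X k \<omega> \<in> anchored_box x})
        = (\<Sum>k\<in>I. if \<forall>j. 0 \<le> X k \<omega> $ j \<and> X k \<omega> $ j < x $ j then 1 else 0)"
      using I by (simp add: anchored_box_def sum.If_cases Int_def)
    then show ?thesis using that by (simp add: D_def S_def measure_anchored_box)
  qed
  have S_meas: "(\<lambda>(\<omega>, x). S \<omega> x) \<in> borel_measurable (M \<Otimes>\<^sub>M lborel)"
  proof -
    note X [measurable]
    show ?thesis unfolding S_def by measurable
  qed
  have D_bound: "\<bar>D \<omega> x\<bar> \<le> 1" if "x \<in> ?C" for \<omega> x
  proof -
    have "card {k \<in> I. X k \<omega> \<in> anchored_box x} \<le> card I"
      using I by (intro card_mono) auto
    then have "real (card {k \<in> I. X k \<omega> \<in> anchored_box x}) / real (card I) \<in> {0..1}"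
      by (auto simp: divide_simps)
    moreover have "measure lborel (anchored_box x) \<in> {0..1}"
      using that by (auto simp: measure_anchored_box intro: prod_nonneg prod_le_1)
    ultimately show ?thesis unfolding D_def atLeastAtMost_iff abs_le_iff by linarith
  qed
  have emeasure_C: "emeasure lborel ?C < \<infinity>"
  proof -
    have "?C = cbox 0 1"
      by (auto simp: mem_box_cart)
    then show ?thesis
      by (simp only: emeasure_lborel_cbox_finite)
  qed
  have "integrable (M \<Otimes>\<^sub>M lborel) (\<lambda>p. indicator (space M \<times> ?C) p *\<^sub>R (case p of (\<omega>, x) \<Rightarrow> S \<omega> x)\<^sup>2)"
  proof (rule integrableI_bounded_set_indicator)
    show "emeasure (M \<Otimes>\<^sub>M lborel) (space M \<times> ?C) < \<infinity>"
      using emeasure_C by (subst lborel.emeasure_pair_measure_Times) (auto simp: emeasure_space_1)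
    show "AE p in M \<Otimes>\<^sub>M lborel. p \<in> space M \<times> ?C \<longrightarrow> norm ((case p of (\<omega>, x) \<Rightarrow> S \<omega> x)\<^sup>2) \<le> 1"
      using D_bound D_eq by (auto simp: abs_square_le_1)
  qed (use S_meas in measurable)
  also have "?this \<longleftrightarrow> integrable (M \<Otimes>\<^sub>M lborel) (\<lambda>(\<omega>, x). indicator ?C x *\<^sub>R (D \<omega> x)\<^sup>2)"
    by (intro Bochner_Integration.integrable_cong refl) (auto simp: space_pair_measure indicator_def D_eq)
  finally have int: "integrable (M \<Otimes>\<^sub>M lborel) (\<lambda>(\<omega>, x). indicator ?C x *\<^sub>R (D \<omega> x)\<^sup>2)" .
  have "expectation (\<lambda>\<omega>. (L2_discrepancy I (\<lambda>k. X k \<omega>))\<^sup>2)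
      = (\<integral>\<omega>. (\<integral>x. indicator ?C x *\<^sub>R (D \<omega> x)\<^sup>2 \<partial>lborel) \<partial>M)"
    by (simp add: L2_discrepancy_squared D_def set_lebesgue_integral_def)
  also have "\<dots> = (\<integral>x. (\<integral>\<omega>. indicator ?C x *\<^sub>R (D \<omega> x)\<^sup>2 \<partial>M) \<partial>lborel)"
    using Fubini_integral[OF int] by simp
  finally show ?thesis
    by (simp add: D_def set_lebesgue_integral_def)
qed

theorem theorem1:
  fixes m :: nat
    and M :: "'w measure"
    and X :: "nat ^ 'd \<Rightarrow> 'w \<Rightarrow> real ^ 'd"
  assumes "m \<ge> 2"
    and "jittered_sample m M X"
  shows "prob_space.expectation M (\<lambda>\<omega>. (L2_discrepancy (multi_indices m) (\<lambda>i. X i \<omega>))\<^sup>2) =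
    1 / real m ^ (2 * CARD('d)) *
      (((real m - 1) / 2 + 1 / 2) ^ CARD('d) - ((real m - 1) / 2 + 1 / 3) ^ CARD('d))"
proof -
  interpret prob_space M using assms(2) by (simp add: jittered_sample_def)
  let ?I = "multi_indices m :: (nat ^ 'd) set"
  let ?C = "{x::real^'d. \<forall>j. x $ j \<in> {0..1}}"
  let ?N = "real m ^ CARD('d)"
  have m: "0 < m" using assms(1) by simp
  have indep: "indep_vars (\<lambda>_. borel) X ?I"
    and distr: "\<And>i. i \<in> ?I \<Longrightarrow> distr M borel (X i) = uniform_measure lborel (jittered_cube m i)"
    using assms(2) by (auto simp: jittered_sample_def)
  have card_I: "real (card ?I) = ?N" by (simp add: card_multi_indices)
  define p where "p i x = (\<Prod>j\<in>UNIV. fraction_below m (i $ j) (x $ j))" for i :: "nat ^ 'd" and x :: "real ^ 'd"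
  \<comment> \<open>Cutting off each factor at the unit interval makes the integrand over the unit cube a product
    over the coordinates.\<close>
  define g where "g n i x = (\<Prod>j\<in>UNIV. indicator {0..1} (x $ j) * fraction_below m (i $ j) (x $ j) ^ n)"
    for n and i :: "nat ^ 'd" and x :: "real ^ 'd"
  have g_eq: "g n i x = indicator ?C x * p i x ^ n" for n i x
  proof (cases "x \<in> ?C")
    case False
    then obtain j where "x $ j \<notin> {0..1}" by auto
    then have "indicator {0..1} (x $ j) = (0 :: real)" by (rule indicator_simps)
    then have "g n i x = 0" unfolding g_def by (intro prod_zero bexI[of _ j]) auto
    then show ?thesis using False by simp
  qed (simp add: g_def p_def prod_power_distrib)
  have variance: "expectation (\<lambda>\<omega>. (real (card {k \<in> ?I. X k \<omega> \<in> anchored_box x}) / real (card ?I)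
      - measure lborel (anchored_box x))\<^sup>2) = (\<Sum>i\<in>?I. p i x - (p i x)\<^sup>2) / ?N\<^sup>2" if x: "x \<in> ?C" for x
  proof -
    have "(\<Sum>i\<in>?I. p i x) = (\<Prod>j\<in>UNIV. \<Sum>k\<in>{1..m}. fraction_below m k (x $ j))"
      unfolding p_def by (rule sum_multi_indices_prod[where f = "\<lambda>j k. fraction_below m k (x $ j)"])
    also have "\<dots> = (\<Prod>j\<in>UNIV. real m * x $ j)"
      using x by (intro prod.cong sum_fraction_below) auto
    also have "\<dots> = ?N * measure lborel (anchored_box x)"
      using x by (simp add: measure_anchored_box prod.distrib)
    finally have mean: "measure lborel (anchored_box x) = (\<Sum>i\<in>?I. p i x) / ?N"
      using m by simp
    have prob: "measure (distr M borel (X i)) (anchored_box x) = p i x" if "i \<in> ?I" for i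
      using that by (simp add: distr p_def measure_uniform_jittered_cube_anchored_box[OF m])
    have "expectation (\<lambda>\<omega>. (real (card {k \<in> ?I. X k \<omega> \<in> anchored_box x}) - (\<Sum>i\<in>?I. p i x))\<^sup>2)
        = (\<Sum>i\<in>?I. p i x - (p i x)\<^sup>2)"
      using variance_count_indep_events[OF finite_multi_indices indep anchored_box_borel[of x]]
      by (simp add: prob)
    then show ?thesis
      unfolding card_I mean by (simp add: power_divide flip: diff_divide_distrib)
  qed
  have int_g: "has_bochner_integral lborel (\<lambda>x. \<Sum>i\<in>?I. g n i x)
      (((real m - 1) / 2 + 1 / real (n + 1)) ^ CARD('d))" if n: "0 < n" for n
  proof -
    let ?c = "\<lambda>k. 1 / (real (n + 1) * real m) + real (m - k) / real m"
    have "has_bochner_integral lborel (g n i) (\<Prod>j\<in>UNIV. ?c (i $ j))" if "i \<in> ?I" for i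
      unfolding g_def[abs_def]
      using that n by (intro has_bochner_integral_vec_prod has_bochner_integral_fraction_below_power)
        (auto simp: multi_indices_def fraction_below_nonneg)
    then have "has_bochner_integral lborel (\<lambda>x. \<Sum>i\<in>?I. g n i x) (\<Sum>i\<in>?I. \<Prod>j\<in>UNIV. ?c (i $ j))"
      by (rule has_bochner_integral_sum)
    also have "(\<Sum>i\<in>?I. \<Prod>j\<in>UNIV. ?c (i $ j)) = (\<Prod>j\<in>(UNIV :: 'd set). \<Sum>k\<in>{1..m}. ?c k)"
      by (rule sum_multi_indices_prod[where f = "\<lambda>_. ?c"])
    also have "(\<Sum>k\<in>{1..m}. ?c k) = (real m - 1) / 2 + 1 / real (n + 1)"
      using sum_fraction_below_integrals[OF m, of "1 / real (n + 1)"] by simp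
    finally show ?thesis by simp
  qed
  have "expectation (\<lambda>\<omega>. (L2_discrepancy ?I (\<lambda>i. X i \<omega>))\<^sup>2)
      = (LINT x:?C|lborel. expectation (\<lambda>\<omega>. (real (card {k \<in> ?I. X k \<omega> \<in> anchored_box x}) / real (card ?I)
          - measure lborel (anchored_box x))\<^sup>2))"
    using indep unfolding indep_vars_def
    by (intro expectation_L2_discrepancy_squared_swap prob_space_axioms finite_multi_indices) auto
  also have "\<dots> = (LINT x:?C|lborel. (\<Sum>i\<in>?I. p i x - (p i x)\<^sup>2) / ?N\<^sup>2)"
  proof (rule set_lebesgue_integral_cong)
    show "?C \<in> sets lborel" by measurable
  qed (use variance in blast)
  also have "\<dots> = (\<integral>x. ((\<Sum>i\<in>?I. g 1 i x) - (\<Sum>i\<in>?I. g 2 i x)) / ?N\<^sup>2 \<partial>lborel)"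
    unfolding set_lebesgue_integral_def
    by (intro Bochner_Integration.integral_cong)
      (auto simp: g_eq sum_subtractf right_diff_distrib diff_divide_distrib simp flip: sum_distrib_left)
  also have "\<dots> = (((real m - 1) / 2 + 1 / 2) ^ CARD('d) - ((real m - 1) / 2 + 1 / 3) ^ CARD('d)) / ?N\<^sup>2"
    using int_g[of 1] int_g[of 2] by (simp add: has_bochner_integral_iff)
  finally show ?thesis
    by (simp add: power_mult mult.commute)
qed

end
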